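(* Let $\mathcal{M}'''_m$ be a meridian surface of parabolic type from the general class, with generating functions $f(u), g(u), \varphi(v)$. Let $a\neq0$ be a constant. Then $\mathcal{M}'''_m$ has constant invariant $k=-a^2$ if and only if $\kappa(v)$ is a constant $b\neq0$ and the meridian $m$ is determined by $f'=y(f)$, where $$y(t)=c\pm\frac{a t^2}{2b},\qquad c=\text{const},$$ and $g(u)$ is defined by $g'(u)=-\dfrac{1}{2f'(u)}$.
   Context: $\mathbb{R}^4_1$ is the four-dimensional Minkowski space with metric $\langle\cdot,\cdot\rangle$ of signature $(3,1)$ and standard orthonormal frame $\{e_1,e_2,e_3,e_4\}$, $\langle e_1,e_1\rangle=\langle e_2,e_2\rangle=\langle e_3,e_3\rangle=1$, $\langle e_4,e_4\rangle=-1$. Put $\xi_1=\frac{e_3+e_4}{\sqrt2}$, $\xi_2=\frac{-e_3+e_4}{\sqrt2}$, so $\langle\xi_1,\xi_1\rangle=\langle\xi_2,\xi_2\rangle=0$, $\langle\xi_1,\xi_2\rangle=-1$. A meridian surface of parabolic type $\mathcal{M}'''_m$ is the spacelike surface $$z(u,v) = f(u)\,\varphi(v)\cos v\, e_1 + f(u)\,\varphi(v)\sin v\, e_2+ \left(f(u)\frac{\varphi(v)^2}{2}+g(u)\right)\xi_1 + f(u)\,\xi_2,\quad u\in I,\ v\in J,$$ where $I,J\subset\mathbb{R}$ are intervals, $f,g:I\to\mathbb{R}$ and $\varphi:J\to\mathbb{R}$ are smooth, $f>0$, $-f'g'>0$ on $I$, and $\dot\varphi^2+\varphi^2>0$ on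 $J$ ($'=d/du$, dot $=d/dv$). The $u$-lines are congruent curves, called the meridians $m$, determined by $f,g$; they are assumed parameterized by arc length, i.e. $-2f'g'=1$. Their curvature is $\kappa_m(u)=\frac{f''(u)}{f'(u)}$. Put $$\kappa(v)=\frac{\varphi\ddot\varphi-2\dot\varphi^2-\varphi^2}{(\dot\varphi^2+\varphi^2)^{3/2}}.$$ The surface is from the general class if $\kappa_m(u)\,\kappa(v)\neq0$ for all $u\in I$, $v\in J$. The mean curvature vector field is $H=\frac12\operatorname{tr}\sigma$, where $\sigma$ is the second fundamental tensor. It is a standing assumption that $\langle H,H\rangle\neq0$ everywhere; put $\varepsilon=\operatorname{sign}\langle H,H\rangle$. Geometric frame: let $X=z_u$, $Y=\frac{z_v}{f\sqrt{\dot\varphi^2+\varphi^2}}$; the principal tangents are $x=\frac{X+Y}{\sqrt2}$, $y=\frac{-X+Y}{\sqrt2}$. Let $b$ be a unit normal field collinear with $H$ ($\langle b,b\rangle=\varepsilon$) and $l$ a normal field with $\langle b,l\rangle=0$, $\langle l,l\rangle=-\varepsilon$ (sign choices do not matter here; this vector field $b$ is unrelated to the constant $b$ in the claim). With $\nabla'$ the Levi-Civita connection of $\mathbb{R}^4_1$, put $\nu_1=\langle\nabla'_xx,b\rangle$, $\nu_2=\langle\nabla'_yy,b\rangle$, $\mu=\langle\nabla'_xy,l\rangle$. The invariant $k$ is $k=-4\nu_1\nu_2\mu^2$; for meridian surfaces of parabolic type it is given by $k=-\frac{\kappa_m^2(u)\,\kappa^2(v)}{f^2(u)}$. The condition "the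 meridian is determined by $f'=y(f)$" means $f'(u)=y(f(u))$ for all $u\in I$ (the function $y(t)$ is unrelated to the tangent field $y$). *)

theory Defs
  imports "HOL-Analysis.Analysis"
begin

(* Intervals may be open, closed or half-open. All derivatives are therefore taken within the
   interval: one-sided at an endpoint that belongs to it, the usual ones at interior points. *)

definition nondegenerate_interval :: "real set \<Rightarrow> bool" where
  "nondegenerate_interval I \<longleftrightarrow> is_interval I \<and> interior I \<noteq> {}"

definition smooth_on_interval :: "real set \<Rightarrow> (real \<Rightarrow> real) \<Rightarrow> bool" where
  "smooth_on_interval I f \<longleftrightarrow>
     (\<exists>F :: nat \<Rightarrow> real \<Rightarrow> real. F 0 = f \<and>
        (\<forall>n. \<forall>x\<in>I. (F n has_real_derivative F (Suc n) x) (at x within I)))"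

definition D :: "real set \<Rightarrow> (real \<Rightarrow> 'a::real_normed_vector) \<Rightarrow> real \<Rightarrow> 'a" where
  "D I f t = vector_derivative f (at t within I)"

type_synonym mink4 = "real ^ 4"

definition mink :: "mink4 \<Rightarrow> mink4 \<Rightarrow> real" where
  "mink x y = x $ 1 * y $ 1 + x $ 2 * y $ 2 + x $ 3 * y $ 3 - x $ 4 * y $ 4"

definition e :: "4 \<Rightarrow> mink4" where
  "e i = axis i 1"

definition xi1 :: mink4 where
  "xi1 = (1 / sqrt 2) *\<^sub>R (e 3 + e 4)"

definition xi2 :: mink4 where
  "xi2 = (1 / sqrt 2) *\<^sub>R (- e 3 + e 4)"

(* Vector fields along a surface z, parametrised over I x J, are functions of (u, v). *)

type_synonym field4 = "real \<Rightarrow> real \<Rightarrow> mink4"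

definition D_u :: "real set \<Rightarrow> field4 \<Rightarrow> field4" where
  "D_u I W u v = D I (\<lambda>s. W s v) u"

definition D_v :: "real set \<Rightarrow> field4 \<Rightarrow> field4" where
  "D_v J W u v = D J (\<lambda>t. W u t) v"

(* A tangent field is represented by its coordinates (p, q) with respect to z_u, z_v. *)

type_synonym coord_field = "real \<Rightarrow> real \<Rightarrow> real \<times> real"

definition tangent_field :: "real set \<Rightarrow> real set \<Rightarrow> field4 \<Rightarrow> coord_field \<Rightarrow> field4" where
  "tangent_field I J z T u v = fst (T u v) *\<^sub>R D_u I z u v + snd (T u v) *\<^sub>R D_v J z u v"

(* The Levi-Civita connection of Minkowski space is flat: its covariant derivative of a field W
   along the surface in the direction p z_u + q z_v is p W_u + q W_v. *)

definition nabla :: "real set \<Rightarrow> real set \<Rightarrow> coord_field \<Rightarrow> field4 \<Rightarrow> field4" where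
  "nabla I J T W u v = fst (T u v) *\<^sub>R D_u I W u v + snd (T u v) *\<^sub>R D_v J W u v"

definition is_normal_at :: "real set \<Rightarrow> real set \<Rightarrow> field4 \<Rightarrow> real \<Rightarrow> real \<Rightarrow> mink4 \<Rightarrow> bool" where
  "is_normal_at I J z u v n \<longleftrightarrow> mink n (D_u I z u v) = 0 \<and> mink n (D_v J z u v) = 0"

(* Existence and uniqueness hold at points where the tangent plane is spacelike. *)

definition normal_part :: "real set \<Rightarrow> real set \<Rightarrow> field4 \<Rightarrow> real \<Rightarrow> real \<Rightarrow> mink4 \<Rightarrow> mink4" where
  "normal_part I J z u v w =
     (THE n. is_normal_at I J z u v n \<and>
        (\<exists>p q. w = n + p *\<^sub>R D_u I z u v + q *\<^sub>R D_v J z u v))"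

definition second_fund :: "real set \<Rightarrow> real set \<Rightarrow> field4 \<Rightarrow> coord_field \<Rightarrow> coord_field \<Rightarrow> field4" where
  "second_fund I J z S T u v =
     normal_part I J z u v (nabla I J S (tangent_field I J z T) u v)"

(* Half the trace of the second fundamental tensor with respect to the first fundamental form
   with coefficients E, F, G. *)

definition mean_curvature_vector :: "real set \<Rightarrow> real set \<Rightarrow> field4 \<Rightarrow> field4" where
  "mean_curvature_vector I J z u v =
     (let E = mink (D_u I z u v) (D_u I z u v);
          F = mink (D_u I z u v) (D_v J z u v);
          G = mink (D_v J z u v) (D_v J z u v);
          du = (\<lambda>_ _. (1, 0));
          dv = (\<lambda>_ _. (0, 1))
      in (1 / 2) *\<^sub>R ((1 / (E * G - F\<^sup>2)) *\<^sub>R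
           (G *\<^sub>R second_fund I J z du du u v
            - (2 * F) *\<^sub>R second_fund I J z du dv u v
            + E *\<^sub>R second_fund I J z dv dv u v)))"

definition meridian_param :: "(real \<Rightarrow> real) \<Rightarrow> (real \<Rightarrow> real) \<Rightarrow> (real \<Rightarrow> real) \<Rightarrow> field4" where
  "meridian_param f g \<phi> u v =
     (f u * \<phi> v * cos v) *\<^sub>R e 1 + (f u * \<phi> v * sin v) *\<^sub>R e 2
     + (f u * (\<phi> v)\<^sup>2 / 2 + g u) *\<^sub>R xi1 + f u *\<^sub>R xi2"

definition meridian_surface ::
  "real set \<Rightarrow> real set \<Rightarrow> (real \<Rightarrow> real) \<Rightarrow> (real \<Rightarrow> real) \<Rightarrow> (real \<Rightarrow> real) \<Rightarrow> bool" where
  "meridian_surface I J f g \<phi> \<longleftrightarrow>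
     nondegenerate_interval I \<and> nondegenerate_interval J \<and>
     smooth_on_interval I f \<and> smooth_on_interval I g \<and> smooth_on_interval J \<phi> \<and>
     (\<forall>u\<in>I. f u > 0) \<and>
     (\<forall>u\<in>I. - (D I f u * D I g u) > 0) \<and>
     (\<forall>v\<in>J. (D J \<phi> v)\<^sup>2 + (\<phi> v)\<^sup>2 > 0)"

definition arc_length_meridian :: "real set \<Rightarrow> (real \<Rightarrow> real) \<Rightarrow> (real \<Rightarrow> real) \<Rightarrow> bool" where
  "arc_length_meridian I f g \<longleftrightarrow> (\<forall>u\<in>I. - 2 * D I f u * D I g u = 1)"

definition kappa_m :: "real set \<Rightarrow> (real \<Rightarrow> real) \<Rightarrow> real \<Rightarrow> real" where
  "kappa_m I f u = D I (D I f) u / D I f u"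

definition kappa :: "real set \<Rightarrow> (real \<Rightarrow> real) \<Rightarrow> real \<Rightarrow> real" where
  "kappa J \<phi> v =
     (\<phi> v * D J (D J \<phi>) v - 2 * (D J \<phi> v)\<^sup>2 - (\<phi> v)\<^sup>2)
       / ((D J \<phi> v)\<^sup>2 + (\<phi> v)\<^sup>2) powr (3 / 2)"

definition general_class ::
  "real set \<Rightarrow> real set \<Rightarrow> (real \<Rightarrow> real) \<Rightarrow> (real \<Rightarrow> real) \<Rightarrow> bool" where
  "general_class I J f \<phi> \<longleftrightarrow> (\<forall>u\<in>I. \<forall>v\<in>J. kappa_m I f u * kappa J \<phi> v \<noteq> 0)"

definition mean_curv ::
  "real set \<Rightarrow> real set \<Rightarrow> (real \<Rightarrow> real) \<Rightarrow> (real \<Rightarrow> real) \<Rightarrow> (real \<Rightarrow> real) \<Rightarrow> field4" where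
  "mean_curv I J f g \<phi> = mean_curvature_vector I J (meridian_param f g \<phi>)"

(* X_crd, Y_crd, x_crd, y_crd are the coordinates of the tangent fields X, Y, x, y. *)

definition X_crd :: coord_field where
  "X_crd u v = (1, 0)"

definition Y_crd :: "real set \<Rightarrow> (real \<Rightarrow> real) \<Rightarrow> (real \<Rightarrow> real) \<Rightarrow> coord_field" where
  "Y_crd J f \<phi> u v = (0, 1 / (f u * sqrt ((D J \<phi> v)\<^sup>2 + (\<phi> v)\<^sup>2)))"

definition x_crd :: "real set \<Rightarrow> (real \<Rightarrow> real) \<Rightarrow> (real \<Rightarrow> real) \<Rightarrow> coord_field" where
  "x_crd J f \<phi> u v = (1 / sqrt 2) *\<^sub>R (X_crd u v + Y_crd J f \<phi> u v)"

definition y_crd :: "real set \<Rightarrow> (real \<Rightarrow> real) \<Rightarrow> (real \<Rightarrow> real) \<Rightarrow> coord_field" where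
  "y_crd J f \<phi> u v = (1 / sqrt 2) *\<^sub>R (- X_crd u v + Y_crd J f \<phi> u v)"

(* nb and nl are the normal fields b and l of the geometric frame; they are determined up to
   sign. No regularity is imposed, since only their pointwise values enter the invariant k. *)

definition geometric_normal_frame ::
  "real set \<Rightarrow> real set \<Rightarrow> (real \<Rightarrow> real) \<Rightarrow> (real \<Rightarrow> real) \<Rightarrow> (real \<Rightarrow> real) \<Rightarrow>
   field4 \<Rightarrow> field4 \<Rightarrow> bool" where
  "geometric_normal_frame I J f g \<phi> nb nl \<longleftrightarrow>
     (\<forall>u\<in>I. \<forall>v\<in>J.
        (let H = mean_curv I J f g \<phi> u v; \<epsilon> = sgn (mink H H) in
           (\<exists>r. nb u v = r *\<^sub>R H) \<and>
           is_normal_at I J (meridian_param f g \<phi>) u v (nb u v) \<and>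
           is_normal_at I J (meridian_param f g \<phi>) u v (nl u v) \<and>
           mink (nb u v) (nb u v) = \<epsilon> \<and>
           mink (nb u v) (nl u v) = 0 \<and>
           mink (nl u v) (nl u v) = - \<epsilon>))"

definition invariant_k ::
  "real set \<Rightarrow> real set \<Rightarrow> (real \<Rightarrow> real) \<Rightarrow> (real \<Rightarrow> real) \<Rightarrow> (real \<Rightarrow> real) \<Rightarrow>
   field4 \<Rightarrow> field4 \<Rightarrow> real \<Rightarrow> real \<Rightarrow> real" where
  "invariant_k I J f g \<phi> nb nl u v =
     (let z = meridian_param f g \<phi>;
          x = x_crd J f \<phi>;
          y = y_crd J f \<phi>;
          \<nu>1 = mink (nabla I J x (tangent_field I J z x) u v) (nb u v);
          \<nu>2 = mink (nabla I J y (tangent_field I J z y) u v) (nb u v);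
          \<mu> = mink (nabla I J x (tangent_field I J z y) u v) (nl u v)
      in - 4 * \<nu>1 * \<nu>2 * \<mu>\<^sup>2)"

end

(* Write z = f L + g xi_1 with the lightlike curve L = phi P + (phi^2 / 2) xi_1 + xi_2, where
   P = (cos v, sin v, 0, 0). Then z_v is a multiple of L', whose length is w = sqrt (phi'^2 + phi^2),
   and a pseudo-orthonormal normal frame consists of a spacelike n_1 orthogonal to L, L', xi_1
   and the timelike n_2 = f' L - g' xi_1. Here z_uu = kappa_m n_2, the field z_uv is tangent, and the
   normal part of z_vv / (f w)^2 is (kappa n_1 + f' n_2) / f. This gives
   k = - (kappa_m kappa / f)^2. If k = - a^2, separation of the variables u and v and connectedness
   make kappa and kappa_m / f = f'' / (f f') constant, and f'' = s f f' integrates to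
   f' = c + s f^2 / 2. *)
theory Submission
  imports Defs
begin

section \<open>Smooth functions on intervals\<close>

text \<open>A connected infinite set has no isolated points. This makes derivatives within
  \<open>I\<close> unique, also at an endpoint that belongs to \<open>I\<close>.\<close>

lemma nondegenerate_interval_at_within:
  assumes "nondegenerate_interval I" "t \<in> I"
  shows "at t within I \<noteq> bot"
proof -
  have "connected I" "infinite I"
    using assms finite_imp_not_open[of "interior I"] finite_subset[OF interior_subset, of I]
    by (auto simp: nondegenerate_interval_def is_interval_connected_1)
  then have "t islimpt I"
    using assms(2) by (intro connected_imp_perfect) (auto dest: infinite_imp_nonempty)
  then show ?thesis
    by (simp add: trivial_limit_within)
qed

lemma D_eqI:
  assumes "nondegenerate_interval I" "t \<in> I" "(f has_vector_derivative f') (at t within I)"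
  shows "D I f t = f'"
  unfolding D_def using assms nondegenerate_interval_at_within
  by (intro vector_derivative_within) auto

lemma D_eqI_transform:
  assumes "nondegenerate_interval I" "t \<in> I" "(h has_vector_derivative f') (at t within I)"
    and "\<And>s. s \<in> I \<Longrightarrow> f s = h s"
  shows "D I f t = f'"
  using assms by (intro D_eqI) (auto intro: has_vector_derivative_transform)

lemma smooth_on_interval_has_derivative:
  assumes "nondegenerate_interval I" "smooth_on_interval I f" "t \<in> I"
  shows "(f has_real_derivative D I f t) (at t within I)"
proof -
  obtain F :: "nat \<Rightarrow> real \<Rightarrow> real" where F: "F 0 = f"
    "\<And>n x. x \<in> I \<Longrightarrow> (F n has_real_derivative F (Suc n) x) (at x within I)"
    using assms(2) unfolding smooth_on_interval_def by blast
  have "(f has_real_derivative F 1 t) (at t within I)"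
    using F(2)[OF assms(3), of 0] unfolding F(1) by simp
  moreover from this have "D I f t = F 1 t"
    using assms by (intro D_eqI) (auto simp: has_real_derivative_iff_has_vector_derivative)
  ultimately show ?thesis by simp
qed

lemma smooth_on_interval_D:
  assumes "nondegenerate_interval I" "smooth_on_interval I f"
  shows "smooth_on_interval I (D I f)"
proof -
  obtain F :: "nat \<Rightarrow> real \<Rightarrow> real" where F: "F 0 = f"
    "\<And>n x. x \<in> I \<Longrightarrow> (F n has_real_derivative F (Suc n) x) (at x within I)"
    using assms(2) unfolding smooth_on_interval_def by blast
  \<comment> \<open>\<open>F 1\<close> agrees with \<open>D I f\<close> only on \<open>I\<close>, so
    a plain shift of \<open>F\<close> would not start with the function \<open>D I f\<close>; index
    0 is therefore set separately.\<close>
  define G where "G n = (if n = 0 then D I f else F (Suc n))" for n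
  have "(G n has_real_derivative G (Suc n) x) (at x within I)" if x: "x \<in> I" for n x
  proof (cases "n = 0")
    case True
    have "D I f t = F (Suc 0) t" if "t \<in> I" for t
      using F(2)[OF that, of 0] assms(1) that unfolding F(1)
      by (intro D_eqI) (simp_all add: has_real_derivative_iff_has_vector_derivative)
    then have "(D I f has_real_derivative F (Suc (Suc 0)) x) (at x within I)"
      using F(2)[OF x, of "Suc 0"] x has_vector_derivative_transform
      unfolding has_real_derivative_iff_has_vector_derivative by blast
    then show ?thesis using True by (simp add: G_def)
  next
    case False
    then show ?thesis using F(2)[OF x, of "Suc n"] by (simp add: G_def)
  qed
  moreover have "G 0 = D I f" by (simp add: G_def)
  ultimately show ?thesis
    unfolding smooth_on_interval_def by blast
qed

lemma smooth_on_interval_continuous: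
  assumes "nondegenerate_interval I" "smooth_on_interval I f"
  shows "continuous_on I f"
  using smooth_on_interval_has_derivative[OF assms] DERIV_continuous
  unfolding continuous_on_eq_continuous_within by blast

text \<open>A continuous function with finite range on a connected set is constant. Thus a square
  that is known pointwise determines the function up to one global sign.\<close>

lemma continuous_on_constant_sq:
  fixes h :: "real \<Rightarrow> real"
  assumes "connected S" "continuous_on S h" "\<And>x. x \<in> S \<Longrightarrow> (h x)\<^sup>2 = c\<^sup>2"
  shows "(\<forall>x\<in>S. h x = c) \<or> (\<forall>x\<in>S. h x = - c)"
proof -
  have im: "h ` S \<subseteq> {c, - c}"
    using assms(3) by (auto simp: power2_eq_iff)
  have "h constant_on S"
    using assms(1,2) im by (intro continuous_finite_range_constant) (auto intro: finite_subset)
  then show ?thesis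
    using im unfolding constant_on_def by auto
qed

section \<open>The moving frame\<close>

lemma mink_add_left: "mink (x + y) z = mink x z + mink y z"
  and mink_add_right: "mink z (x + y) = mink z x + mink z y"
  and mink_scale_left: "mink (r *\<^sub>R x) z = r * mink x z"
  and mink_scale_right: "mink z (r *\<^sub>R x) = r * mink z x"
  and mink_diff_left: "mink (x - y) z = mink x z - mink y z"
  and mink_diff_right: "mink z (x - y) = mink z x - mink z y"
  by (simp_all add: mink_def algebra_simps)

lemmas mink_bilinear = mink_add_left mink_add_right mink_scale_left mink_scale_right
  mink_diff_left mink_diff_right

lemma mink_commute: "mink x y = mink y x"
  by (simp add: mink_def algebra_simps)

text \<open>Coordinates in the rotating frame P, P', xi_1, xi_2 with P = (cos v, sin v, 0, 0). P and
  P' are orthonormal for every v, so products of two vectors at the same v do not involve the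
  angle.\<close>

definition frame_vec :: "real \<Rightarrow> real \<Rightarrow> real \<Rightarrow> real \<Rightarrow> real \<Rightarrow> mink4" where
  "frame_vec v a b c d =
     a *\<^sub>R (cos v *\<^sub>R e 1 + sin v *\<^sub>R e 2) + b *\<^sub>R (cos v *\<^sub>R e 2 - sin v *\<^sub>R e 1) + c *\<^sub>R xi1 + d *\<^sub>R xi2"

lemma frame_vec_nth:
  "frame_vec v a b c d $ 1 = a * cos v - b * sin v"
  "frame_vec v a b c d $ 2 = a * sin v + b * cos v"
  "frame_vec v a b c d $ 3 = (c - d) / sqrt 2"
  "frame_vec v a b c d $ 4 = (c + d) / sqrt 2"
  by (simp_all add: frame_vec_def e_def xi1_def xi2_def axis_def field_simps)

lemma mink_frame_vec:
  "mink (frame_vec v a b c d) (frame_vec v a' b' c' d') = a * a' + b * b' - c * d' - d * c'"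
proof -
  have 1: "(a * cos v - b * sin v) * (a' * cos v - b' * sin v)
      + (a * sin v + b * cos v) * (a' * sin v + b' * cos v) = (a * a' + b * b') * ((sin v)\<^sup>2 + (cos v)\<^sup>2)"
    by (simp only: algebra_simps power2_eq_square)
  have 2: "(c - d) / sqrt 2 * ((c' - d') / sqrt 2) - (c + d) / sqrt 2 * ((c' + d') / sqrt 2)
      = - c * d' - d * c'"
    by (simp add: field_simps)
  show ?thesis
    unfolding mink_def frame_vec_nth using 1 2 by simp
qed

lemma frame_vec_add:
  "frame_vec v a b c d + frame_vec v a' b' c' d' = frame_vec v (a + a') (b + b') (c + c') (d + d')"
  by (simp add: frame_vec_def algebra_simps)

lemma frame_vec_scale:
  "r *\<^sub>R frame_vec v a b c d = frame_vec v (r * a) (r * b) (r * c) (r * d)"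
  by (simp add: frame_vec_def algebra_simps)

lemma frame_vec_surj: "\<exists>a b c d. w = frame_vec v a b c d"
proof -
  have sq: "t = cos v * (cos v * t) + sin v * (sin v * t)" for t
    using arg_cong[OF sin_cos_squared_add[of v], of "\<lambda>s. s * t"]
    unfolding distrib_right power2_eq_square mult.assoc mult_1 by linarith
  \<comment> \<open>The coefficients are the products of \<open>w\<close> with P and P' and, because
    xi_1 and xi_2 are lightlike with product -1, minus its products with xi_2 and xi_1.\<close>
  have "w = frame_vec v (w $ 1 * cos v + w $ 2 * sin v) (w $ 2 * cos v - w $ 1 * sin v)
      ((w $ 3 + w $ 4) / sqrt 2) ((w $ 4 - w $ 3) / sqrt 2)"
    unfolding vec_eq_iff forall_4 frame_vec_nth
    using sq[of "w $ 1"] sq[of "w $ 2"]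
    by (simp add: algebra_simps add_divide_distrib diff_divide_distrib)
  then show ?thesis by blast
qed

text \<open>The terms \<open>- b v\<close> and \<open>+ a v\<close> come from the rotation of the
  frame, since P'' = -P.\<close>

lemma frame_vec_has_vector_derivative_angle:
  assumes "(a has_real_derivative a') (at v within J)" "(b has_real_derivative b') (at v within J)"
    "(c has_real_derivative c') (at v within J)" "(d has_real_derivative d') (at v within J)"
  shows "((\<lambda>t. frame_vec t (a t) (b t) (c t) (d t)) has_vector_derivative
    frame_vec v (a' - b v) (b' + a v) c' d') (at v within J)"
proof -
  note scale_const = has_vector_derivative_scaleR[OF _ has_vector_derivative_const]
  have sc: "(sin has_real_derivative cos v) (at v within J)"
    "(cos has_real_derivative - sin v) (at v within J)"
    by (auto intro!: derivative_eq_intros)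
  have P: "((\<lambda>t. cos t *\<^sub>R e 1 + sin t *\<^sub>R e 2) has_vector_derivative
      cos v *\<^sub>R e 2 - sin v *\<^sub>R e 1) (at v within J)"
    using has_vector_derivative_add[OF scale_const[OF sc(2), of "e 1"] scale_const[OF sc(1), of "e 2"]]
    by simp
  have Q: "((\<lambda>t. cos t *\<^sub>R e 2 - sin t *\<^sub>R e 1) has_vector_derivative
      - (sin v *\<^sub>R e 2) - cos v *\<^sub>R e 1) (at v within J)"
    using has_vector_derivative_diff[OF scale_const[OF sc(2), of "e 2"] scale_const[OF sc(1), of "e 1"]]
    by (simp add: algebra_simps)
  show ?thesis
    unfolding frame_vec_def
    using has_vector_derivative_add[OF has_vector_derivative_add[OF has_vector_derivative_add[OF
      has_vector_derivative_scaleR[OF assms(1) P] has_vector_derivative_scaleR[OF assms(2) Q]]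
      scale_const[OF assms(3), of xi1]] scale_const[OF assms(4), of xi2]]
    by (simp add: algebra_simps)
qed

lemma xi1_frame_vec: "xi1 = frame_vec v 0 0 1 0"
  by (simp add: frame_vec_def)

section \<open>Normal components\<close>

text \<open>Two candidates differ by a vector that is both tangent and normal, and a nonzero Gram
  determinant forces this vector to vanish.\<close>

lemma normal_part_eqI:
  assumes n: "is_normal_at I J z u v n"
    and w: "w = n + p *\<^sub>R D_u I z u v + q *\<^sub>R D_v J z u v"
    and det: "mink (D_u I z u v) (D_u I z u v) * mink (D_v J z u v) (D_v J z u v)
      - (mink (D_u I z u v) (D_v J z u v))\<^sup>2 \<noteq> 0"
  shows "normal_part I J z u v w = n"
  unfolding normal_part_def
proof (rule the_equality)
  show "is_normal_at I J z u v n \<and> (\<exists>p q. w = n + p *\<^sub>R D_u I z u v + q *\<^sub>R D_v J z u v)"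
    using n w by blast
next
  let ?X = "D_u I z u v" and ?Y = "D_v J z u v"
  fix n' assume "is_normal_at I J z u v n' \<and> (\<exists>p q. w = n' + p *\<^sub>R ?X + q *\<^sub>R ?Y)"
  then obtain p' q' where n': "is_normal_at I J z u v n'" "w = n' + p' *\<^sub>R ?X + q' *\<^sub>R ?Y"
    by blast
  define r s where "r = p - p'" and "s = q - q'"
  have diff: "n' - n = r *\<^sub>R ?X + s *\<^sub>R ?Y"
    using w n'(2) unfolding r_def s_def by (simp add: algebra_simps)
  have "mink (n' - n) ?X = 0" "mink (n' - n) ?Y = 0"
    using n n'(1) by (simp_all add: is_normal_at_def mink_bilinear)
  then have eqs: "r * mink ?X ?X + s * mink ?X ?Y = 0" "r * mink ?X ?Y + s * mink ?Y ?Y = 0"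
    unfolding diff by (simp_all add: mink_bilinear mink_commute[of ?Y ?X])
  \<comment> \<open>Cramer's rule for the homogeneous system \<open>eqs\<close>.\<close>
  have "r * (mink ?X ?X * mink ?Y ?Y - (mink ?X ?Y)\<^sup>2)
      = mink ?Y ?Y * (r * mink ?X ?X + s * mink ?X ?Y) - mink ?X ?Y * (r * mink ?X ?Y + s * mink ?Y ?Y)"
    "s * (mink ?X ?X * mink ?Y ?Y - (mink ?X ?Y)\<^sup>2)
      = mink ?X ?X * (r * mink ?X ?Y + s * mink ?Y ?Y) - mink ?X ?Y * (r * mink ?X ?X + s * mink ?X ?Y)"
    by (simp_all add: algebra_simps power2_eq_square)
  then have "r = 0" "s = 0"
    using det unfolding eqs by simp_all
  then show "n' = n" using diff by simp
qed

section \<open>Meridian surfaces of parabolic type\<close>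

locale arc_length_meridian_surface =
  fixes I J :: "real set" and f g \<phi> :: "real \<Rightarrow> real"
  assumes surface: "meridian_surface I J f g \<phi>"
    and arc_length: "arc_length_meridian I f g"
begin

abbreviation "z \<equiv> meridian_param f g \<phi>"
abbreviation "f1 \<equiv> D I f"
abbreviation "f2 \<equiv> D I (D I f)"
abbreviation "g1 \<equiv> D I g"
abbreviation "g2 \<equiv> D I (D I g)"
abbreviation "\<phi>1 \<equiv> D J \<phi>"
abbreviation "\<phi>2 \<equiv> D J (D J \<phi>)"
abbreviation "\<kappa>m \<equiv> kappa_m I f"
abbreviation "\<kappa> \<equiv> kappa J \<phi>"

text \<open>In terms of the lightlike curve \<open>L\<close> the surface is \<open>z = f L + g \<xi>\<^sub>1\<close>.\<close>

definition L :: "real \<Rightarrow> mink4" where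
  "L v = frame_vec v (\<phi> v) 0 ((\<phi> v)\<^sup>2 / 2) 1"

definition L1 :: "real \<Rightarrow> mink4" where
  "L1 v = frame_vec v (\<phi>1 v) (\<phi> v) (\<phi> v * \<phi>1 v) 0"

definition L2 :: "real \<Rightarrow> mink4" where
  "L2 v = frame_vec v (\<phi>2 v - \<phi> v) (2 * \<phi>1 v) ((\<phi>1 v)\<^sup>2 + \<phi> v * \<phi>2 v) 0"

definition speed :: "real \<Rightarrow> real" where
  "speed v = sqrt ((\<phi>1 v)\<^sup>2 + (\<phi> v)\<^sup>2)"

text \<open>A quarter turn of the P, P' part of \<open>L1 v\<close> gives orthogonality to
  \<open>L1 v\<close>; the xi_1 coefficient is then forced by orthogonality to
  \<open>L v\<close>.\<close>

definition n1 :: "real \<Rightarrow> mink4" where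
  "n1 v = (1 / speed v) *\<^sub>R frame_vec v (\<phi> v) (- \<phi>1 v) ((\<phi> v)\<^sup>2) 0"

text \<open>This is z_u with the sign of its xi_1 term reversed, hence orthogonal to z_u in the
  Lorentzian plane of \<open>L v\<close> and xi_1, and of opposite square.\<close>

definition n2 :: "real \<Rightarrow> real \<Rightarrow> mink4" where
  "n2 u v = f1 u *\<^sub>R L v - g1 u *\<^sub>R xi1"

section \<open>Generating functions and their curvatures\<close>

lemma intervals: "nondegenerate_interval I" "nondegenerate_interval J"
  using surface by (simp_all add: meridian_surface_def)

lemma smooth:
  "smooth_on_interval I f" "smooth_on_interval I g" "smooth_on_interval J \<phi>"
  using surface by (simp_all add: meridian_surface_def)

lemma derivs_I:
  assumes "u \<in> I"
  shows "(f has_real_derivative f1 u) (at u within I)"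
    and "(g has_real_derivative g1 u) (at u within I)"
    and "(f1 has_real_derivative f2 u) (at u within I)"
    and "(g1 has_real_derivative g2 u) (at u within I)"
  using assms intervals smooth
  by (auto intro!: smooth_on_interval_has_derivative smooth_on_interval_D)

lemma derivs_J:
  assumes "v \<in> J"
  shows "(\<phi> has_real_derivative \<phi>1 v) (at v within J)"
    and "(\<phi>1 has_real_derivative \<phi>2 v) (at v within J)"
  using assms intervals smooth
  by (auto intro!: smooth_on_interval_has_derivative smooth_on_interval_D)

lemma f_pos: "u \<in> I \<Longrightarrow> f u > 0"
  using surface by (simp add: meridian_surface_def)

lemma f1_g1: "u \<in> I \<Longrightarrow> f1 u * g1 u = - 1 / 2"
  using arc_length by (auto simp: arc_length_meridian_def)

lemma f1_nonzero: "u \<in> I \<Longrightarrow> f1 u \<noteq> 0"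
  using f1_g1 by force

lemma g1_eq: "u \<in> I \<Longrightarrow> g1 u = - 1 / (2 * f1 u)"
  using f1_g1[of u] f1_nonzero[of u] by (simp add: field_simps)

lemma speed_pos: "v \<in> J \<Longrightarrow> speed v > 0"
  using surface by (simp add: meridian_surface_def speed_def)

lemma speed_sq: "(speed v)\<^sup>2 = (\<phi>1 v)\<^sup>2 + (\<phi> v)\<^sup>2"
  by (simp add: speed_def)

lemma f2_eq:
  assumes "u \<in> I"
  shows "f2 u = \<kappa>m u * f1 u"
  using f1_nonzero[OF assms] by (simp add: kappa_m_def)

text \<open>Obtained by differentiating the arc length condition f' g' = -1/2.\<close>

lemma g2_eq:
  assumes u: "u \<in> I"
  shows "g2 u = - \<kappa>m u * g1 u"
proof -
  have "((\<lambda>s. f1 s * g1 s) has_real_derivative f2 u * g1 u + g2 u * f1 u) (at u within I)"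
    by (rule DERIV_mult derivs_I u)+
  then have "D I (\<lambda>s. f1 s * g1 s) u = f2 u * g1 u + g2 u * f1 u"
    using intervals u by (intro D_eqI) (simp_all add: has_real_derivative_iff_has_vector_derivative)
  moreover have "D I (\<lambda>s. f1 s * g1 s) u = 0"
    using intervals u f1_g1 by (intro D_eqI_transform[where h = "\<lambda>_. - 1 / 2"]) simp_all
  ultimately have "(\<kappa>m u * g1 u + g2 u) * f1 u = 0"
    by (simp add: f2_eq u algebra_simps)
  then show ?thesis using f1_nonzero[OF u] by simp
qed

text \<open>Trading the real power 3/2 for a cube of \<open>speed v\<close> turns later computations
  with \<open>\<kappa>\<close> into polynomial identities.\<close>

lemma kappa_eq:
  assumes "v \<in> J"
  shows "\<kappa> v * speed v ^ 3 = \<phi> v * \<phi>2 v - 2 * (\<phi>1 v)\<^sup>2 - (\<phi> v)\<^sup>2"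
proof -
  have "((\<phi>1 v)\<^sup>2 + (\<phi> v)\<^sup>2) powr (3 / 2) = speed v ^ 3"
    using speed_pos[OF assms] powr_powr[of "speed v" 2 "3 / 2"] powr_realpow[of "speed v" 3]
      powr_realpow[of "speed v" 2]
    by (simp add: speed_sq)
  then show ?thesis
    using speed_pos[OF assms] by (simp add: kappa_def)
qed

section \<open>The lightlike curve and the products of the frame vectors\<close>

lemma L_has_derivative:
  assumes "v \<in> J"
  shows "(L has_vector_derivative L1 v) (at v within J)"
    and "(L1 has_vector_derivative L2 v) (at v within J)"
proof -
  have sq: "((\<lambda>v. (\<phi> v)\<^sup>2 / 2) has_real_derivative \<phi> v * \<phi>1 v) (at v within J)"
    by (auto intro!: derivative_eq_intros derivs_J assms)
  show "(L has_vector_derivative L1 v) (at v within J)"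
    using frame_vec_has_vector_derivative_angle[OF derivs_J(1)[OF assms] DERIV_const[of 0] sq DERIV_const[of 1]]
    by (simp add: L_def[abs_def] L1_def)
  have mult: "((\<lambda>v. \<phi> v * \<phi>1 v) has_real_derivative \<phi>1 v * \<phi>1 v + \<phi>2 v * \<phi> v) (at v within J)"
    by (rule DERIV_mult derivs_J assms)+
  show "(L1 has_vector_derivative L2 v) (at v within J)"
    using frame_vec_has_vector_derivative_angle[OF derivs_J(2)[OF assms] derivs_J(1)[OF assms] mult DERIV_const[of 0]]
    by (simp add: L1_def[abs_def] L2_def power2_eq_square mult.commute)
qed

lemma mink_L:
  "mink (L v) (L v) = 0" "mink (L v) (L1 v) = 0" "mink (L1 v) (L v) = 0"
  "mink (L v) xi1 = - 1" "mink xi1 (L v) = - 1" "mink (L1 v) xi1 = 0" "mink xi1 (L1 v) = 0"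
  "mink xi1 xi1 = 0" "mink (L1 v) (L1 v) = (speed v)\<^sup>2"
  "mink (n1 v) (L v) = 0" "mink (L v) (n1 v) = 0" "mink (n1 v) (L1 v) = 0"
  "mink (n1 v) xi1 = 0" "mink xi1 (n1 v) = 0"
  unfolding L_def L1_def xi1_frame_vec[of v] n1_def mink_scale_left mink_scale_right mink_frame_vec speed_sq
  by (simp_all add: power2_eq_square)

lemma mink_n1:
  assumes "v \<in> J"
  shows "mink (n1 v) (n1 v) = 1"
proof -
  have "mink (frame_vec v (\<phi> v) (- \<phi>1 v) ((\<phi> v)\<^sup>2) 0) (frame_vec v (\<phi> v) (- \<phi>1 v) ((\<phi> v)\<^sup>2) 0) = (speed v)\<^sup>2"
    unfolding speed_sq by (simp add: mink_frame_vec power2_eq_square)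
  then show ?thesis
    using speed_pos[OF assms]
    unfolding n1_def mink_scale_left mink_scale_right by (simp add: power2_eq_square)
qed

lemma mink_n2:
  shows "mink (n1 v) (n2 u v) = 0" "mink (n2 u v) (n1 v) = 0"
    and "u \<in> I \<Longrightarrow> mink (n2 u v) (n2 u v) = - 1"
  using f1_g1[of u]
  by (simp_all add: n2_def mink_bilinear mink_L mink_commute[of "L v" "n1 v"] mult.commute)

section \<open>Second derivatives of the surface\<close>

lemma z_eq: "z u v = f u *\<^sub>R L v + g u *\<^sub>R xi1"
  by (simp add: meridian_param_def L_def frame_vec_def algebra_simps)

text \<open>For fixed v the vectors \<open>L v\<close>, \<open>L1 v\<close> and xi_1 are constant in
  u, so only scalar coefficients are differentiated; \<open>C\<close> collects what does not depend
  on u.\<close>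

lemma D_u_comb:
  assumes "u \<in> I" "\<And>s. s \<in> I \<Longrightarrow> W s v = a s *\<^sub>R A + b s *\<^sub>R B + C"
    "(a has_real_derivative a') (at u within I)" "(b has_real_derivative b') (at u within I)"
  shows "D_u I W u v = a' *\<^sub>R A + b' *\<^sub>R B"
proof -
  note scale_const = has_vector_derivative_scaleR[OF _ has_vector_derivative_const]
  have "((\<lambda>s. a s *\<^sub>R A + b s *\<^sub>R B + C) has_vector_derivative a' *\<^sub>R A + b' *\<^sub>R B) (at u within I)"
    using has_vector_derivative_add[OF has_vector_derivative_add[OF
      scale_const[OF assms(3), of A] scale_const[OF assms(4), of B]] has_vector_derivative_const[of C]]
    by simp
  then show ?thesis
    unfolding D_u_def using assms(1,2) intervals by (intro D_eqI_transform) auto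
qed

lemma z_u: "u \<in> I \<Longrightarrow> D_u I z u v = f1 u *\<^sub>R L v + g1 u *\<^sub>R xi1"
  using derivs_I by (intro D_u_comb[where C = 0]) (auto simp: z_eq)

lemma z_v:
  assumes "v \<in> J"
  shows "D_v J z u v = f u *\<^sub>R L1 v"
  using has_vector_derivative_add[OF has_vector_derivative_scaleR[OF DERIV_const[of "f u"]
    L_has_derivative(1)[OF assms]] has_vector_derivative_const[of "g u *\<^sub>R xi1"]] assms intervals
  unfolding D_v_def z_eq by (intro D_eqI) auto

text \<open>The opposite signs in \<open>f2_eq\<close> and \<open>g2_eq\<close> turn z_u into
  \<open>n2\<close>: the meridian has unit speed, so its acceleration is orthogonal to z_u.\<close>

lemma z_uu:
  assumes "u \<in> I"
  shows "D_u I (D_u I z) u v = \<kappa>m u *\<^sub>R n2 u v"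
proof -
  have "D_u I (D_u I z) u v = f2 u *\<^sub>R L v + g2 u *\<^sub>R xi1"
    by (rule D_u_comb[where C = 0 and a = f1 and b = g1]) (simp_all add: assms z_u derivs_I)
  then show ?thesis
    by (simp add: assms f2_eq g2_eq n2_def algebra_simps)
qed

lemma z_vv:
  assumes "v \<in> J"
  shows "D_v J (D_v J z) u v = f u *\<^sub>R L2 v"
  using has_vector_derivative_scaleR[OF DERIV_const[of "f u"] L_has_derivative(2)[OF assms]] assms intervals
  unfolding D_v_def[of _ "D_v J z"] by (intro D_eqI_transform) (auto simp: z_v)

text \<open>\<open>n2\<close> minus z_u equals -2 g' xi_1, and -2 f' g' = 1. This splits xi_1 into a
  normal and a tangent part.\<close>

lemma xi1_eq:
  assumes "u \<in> I"
  shows "xi1 = f1 u *\<^sub>R n2 u v - f1 u *\<^sub>R D_u I z u v"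
proof -
  have "f1 u *\<^sub>R n2 u v - f1 u *\<^sub>R D_u I z u v = (- 2 * (f1 u * g1 u)) *\<^sub>R xi1"
    unfolding z_u[OF assms] n2_def by (simp add: vec_eq_iff algebra_simps)
  then show ?thesis using f1_g1[OF assms] by simp
qed

text \<open>\<open>L2 v\<close> has no xi_2 component, so it lies in the span of
  \<open>L1 v\<close>, \<open>n1 v\<close> and xi_1. The first two coefficients come from its
  products with \<open>L1 v\<close> and \<open>n1 v\<close>; the third is minus its product with
  \<open>L v\<close>, which equals the square of \<open>L1 v\<close> because \<open>L\<close> and
  \<open>L1\<close> are orthogonal along the curve.\<close>

lemma L2_eq:
  assumes "v \<in> J"
  shows "L2 v = ((\<phi>1 v * \<phi>2 v + \<phi> v * \<phi>1 v) / (speed v)\<^sup>2) *\<^sub>R L1 v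
    + (\<kappa> v * (speed v)\<^sup>2) *\<^sub>R n1 v + (speed v)\<^sup>2 *\<^sub>R xi1"
proof -
  let ?w = "speed v"
  define t where "t = (\<phi>1 v * \<phi>2 v + \<phi> v * \<phi>1 v) / ?w\<^sup>2"
  have w: "?w \<noteq> 0" using speed_pos[OF assms] by simp
  have t: "t * ?w\<^sup>2 = \<phi>1 v * \<phi>2 v + \<phi> v * \<phi>1 v"
    using w by (simp add: t_def)
  have K: "\<kappa> v * ?w * ?w\<^sup>2 = \<phi> v * \<phi>2 v - 2 * (\<phi>1 v)\<^sup>2 - (\<phi> v)\<^sup>2"
    using kappa_eq[OF assms] by (simp add: power2_eq_square power3_eq_cube mult.assoc)
  \<comment> \<open>The P and P' coordinates are compared after multiplication by the squared speed,
    which clears the denominators of \<open>t\<close> and \<open>\<kappa>\<close>.\<close>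
  have "(t * \<phi>1 v + \<kappa> v * ?w * \<phi> v) * ?w\<^sup>2 = (t * ?w\<^sup>2) * \<phi>1 v + (\<kappa> v * ?w * ?w\<^sup>2) * \<phi> v"
    "(t * \<phi> v - \<kappa> v * ?w * \<phi>1 v) * ?w\<^sup>2 = (t * ?w\<^sup>2) * \<phi> v - (\<kappa> v * ?w * ?w\<^sup>2) * \<phi>1 v"
    by (simp_all add: algebra_simps)
  then have "(t * \<phi>1 v + \<kappa> v * ?w * \<phi> v) * ?w\<^sup>2 = (\<phi>2 v - \<phi> v) * ?w\<^sup>2"
    "(t * \<phi> v - \<kappa> v * ?w * \<phi>1 v) * ?w\<^sup>2 = (2 * \<phi>1 v) * ?w\<^sup>2"
    unfolding t K unfolding speed_sq by (simp_all add: algebra_simps power2_eq_square)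
  then have c: "t * \<phi>1 v + \<kappa> v * ?w * \<phi> v = \<phi>2 v - \<phi> v"
    "t * \<phi> v - \<kappa> v * ?w * \<phi>1 v = 2 * \<phi>1 v"
    using w by simp_all
  \<comment> \<open>The xi_1 coordinate reduces to the P coordinate just found.\<close>
  have "t * (\<phi> v * \<phi>1 v) + \<kappa> v * ?w * (\<phi> v)\<^sup>2 + ?w\<^sup>2
      = \<phi> v * (t * \<phi>1 v + \<kappa> v * ?w * \<phi> v) + ?w\<^sup>2"
    by (simp add: algebra_simps power2_eq_square)
  also have "\<dots> = (\<phi>1 v)\<^sup>2 + \<phi> v * \<phi>2 v"
    unfolding c speed_sq by (simp add: algebra_simps power2_eq_square)
  finally have c3: "t * (\<phi> v * \<phi>1 v) + \<kappa> v * ?w * (\<phi> v)\<^sup>2 + ?w\<^sup>2 = (\<phi>1 v)\<^sup>2 + \<phi> v * \<phi>2 v" .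
  have "t *\<^sub>R L1 v + (\<kappa> v * ?w\<^sup>2) *\<^sub>R n1 v + ?w\<^sup>2 *\<^sub>R xi1
     = frame_vec v (t * \<phi>1 v + \<kappa> v * ?w * \<phi> v) (t * \<phi> v - \<kappa> v * ?w * \<phi>1 v)
        (t * (\<phi> v * \<phi>1 v) + \<kappa> v * ?w * (\<phi> v)\<^sup>2 + ?w\<^sup>2) 0"
    using w unfolding L1_def n1_def xi1_frame_vec[of v]
    by (simp add: frame_vec_add frame_vec_scale power2_eq_square mult.assoc)
  then show ?thesis
    unfolding c c3 L2_def t_def[symmetric] by simp
qed

section \<open>First fundamental form and mean curvature vector\<close>

lemma is_normal_n:
  assumes "u \<in> I" "v \<in> J"
  shows "is_normal_at I J z u v (\<alpha> *\<^sub>R n1 v + \<beta> *\<^sub>R n2 u v)"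
  using assms by (simp add: is_normal_at_def z_u z_v n2_def mink_bilinear mink_L mult.commute)

lemma first_fundamental_form:
  assumes "u \<in> I" "v \<in> J"
  shows "mink (D_u I z u v) (D_u I z u v) = 1" "mink (D_u I z u v) (D_v J z u v) = 0"
    "mink (D_v J z u v) (D_v J z u v) = (f u * speed v)\<^sup>2"
  using assms f1_g1[OF assms(1)]
  by (simp_all add: z_u z_v mink_bilinear mink_L mult.commute power_mult_distrib power2_eq_square)

lemma normal_partI:
  assumes "u \<in> I" "v \<in> J"
    and "w = (\<alpha> *\<^sub>R n1 v + \<beta> *\<^sub>R n2 u v) + p *\<^sub>R D_u I z u v + q *\<^sub>R D_v J z u v"
  shows "normal_part I J z u v w = \<alpha> *\<^sub>R n1 v + \<beta> *\<^sub>R n2 u v"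
  using assms f_pos[OF assms(1)] speed_pos[OF assms(2)]
  by (intro normal_part_eqI is_normal_n) (auto simp: first_fundamental_form)

lemma z_vv_eq:
  assumes "u \<in> I" "v \<in> J"
  shows "D_v J (D_v J z) u v = (f u * (speed v)\<^sup>2) *\<^sub>R (\<kappa> v *\<^sub>R n1 v + f1 u *\<^sub>R n2 u v)
    - (f u * (speed v)\<^sup>2 * f1 u) *\<^sub>R D_u I z u v
    + ((\<phi>1 v * \<phi>2 v + \<phi> v * \<phi>1 v) / (speed v)\<^sup>2) *\<^sub>R D_v J z u v"
  unfolding z_vv[OF assms(2)] z_v[OF assms(2)] L2_eq[OF assms(2)]
  by (subst xi1_eq[OF assms(1), of v]) (simp add: algebra_simps)

text \<open>Since E = 1, F = 0 and G = (f w)^2 with w the speed, H is half the sum of the normal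
  parts of z_uu and z_vv / (f w)^2.\<close>

lemma mean_curv_eq:
  assumes "u \<in> I" "v \<in> J"
  shows "mean_curv I J f g \<phi> u v
    = (\<kappa> v / (2 * f u)) *\<^sub>R n1 v + ((\<kappa>m u + f1 u / f u) / 2) *\<^sub>R n2 u v"
proof -
  let ?du = "\<lambda>_ _. (1, 0) :: real \<times> real" and ?dv = "\<lambda>_ _. (0, 1) :: real \<times> real"
  have du: "tangent_field I J z ?du = D_u I z" and dv: "tangent_field I J z ?dv = D_v J z"
    by (simp_all add: tangent_field_def fun_eq_iff)
  have uu: "second_fund I J z ?du ?du u v = \<kappa>m u *\<^sub>R n2 u v"
    unfolding second_fund_def nabla_def du
    using normal_partI[OF assms, of _ 0 _ 0 0] by (simp add: z_uu assms)
  have "second_fund I J z ?dv ?dv u v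
      = (f u * (speed v)\<^sup>2 * \<kappa> v) *\<^sub>R n1 v + (f u * (speed v)\<^sup>2 * f1 u) *\<^sub>R n2 u v"
    unfolding second_fund_def nabla_def dv
    by (rule normal_partI[OF assms, where p = "- (f u * (speed v)\<^sup>2 * f1 u)"
      and q = "(\<phi>1 v * \<phi>2 v + \<phi> v * \<phi>1 v) / (speed v)\<^sup>2"])
      (simp add: z_vv_eq assms algebra_simps)
  then show ?thesis
    unfolding mean_curv_def mean_curvature_vector_def Let_def uu first_fundamental_form[OF assms]
    using f_pos[OF assms(1)] speed_pos[OF assms(2)]
    by (simp add: algebra_simps power2_eq_square add_divide_distrib)
qed

section \<open>Principal tangents and the invariant k\<close>

text \<open>\<open>s = 1\<close> gives the principal tangent \<open>x\<close> and \<open>s = - 1\<close> gives \<open>y\<close>.\<close>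

definition tangent :: "real \<Rightarrow> coord_field" where
  "tangent s u v = (s / sqrt 2, 1 / (sqrt 2 * f u * speed v))"

lemma principal_tangents: "x_crd J f \<phi> = tangent 1" "y_crd J f \<phi> = tangent (- 1)"
  by (auto simp: x_crd_def y_crd_def X_crd_def Y_crd_def tangent_def speed_def fun_eq_iff)

text \<open>The factor f of z_v cancels, so the coefficient of \<open>L1 v\<close> is constant in
  u.\<close>

lemma tangent_field_tangent:
  assumes "u \<in> I" "v \<in> J"
  shows "tangent_field I J z (tangent s) u v
    = (s / sqrt 2 * f1 u) *\<^sub>R L v + (s / sqrt 2 * g1 u) *\<^sub>R xi1 + (1 / (sqrt 2 * speed v)) *\<^sub>R L1 v"
  using assms f_pos[OF assms(1)]
  by (simp add: tangent_field_def tangent_def z_u z_v scaleR_add_right)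

text \<open>The product \<open>r * s\<close> accompanies the uu part and 1 the vv part. The mixed
  terms are multiples of \<open>L1 v\<close>, which is tangent and vanishes against
  \<open>n\<close>.\<close>

lemma mink_nabla_tangent:
  assumes u: "u \<in> I" and v: "v \<in> J" and n: "is_normal_at I J z u v n"
  shows "mink (nabla I J (tangent r) (tangent_field I J z (tangent s)) u v) n
    = (r * s * \<kappa>m u * mink n (n2 u v) + (\<kappa> v * mink n (n1 v) + f1 u * mink n (n2 u v)) / f u) / 2"
proof -
  let ?T = "tangent_field I J z (tangent s)" and ?m = "\<lambda>v. 1 / (sqrt 2 * speed v)"
  have fw: "f u > 0" "speed v > 0"
    using f_pos u speed_pos v by auto
  have "((\<lambda>v. (\<phi>1 v)\<^sup>2 + (\<phi> v)\<^sup>2) has_real_derivative 2 * \<phi>1 v * \<phi>2 v + 2 * \<phi> v * \<phi>1 v) (at v within J)"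
    by (auto intro!: derivative_eq_intros derivs_J v)
  from DERIV_chain2[OF DERIV_real_sqrt this] obtain w' where
    "(speed has_real_derivative w') (at v within J)"
    using fw unfolding speed_def[abs_def] by auto
  \<comment> \<open>Existence of the derivative of the normalizing factor suffices, as its value
    only multiplies the tangent vector \<open>L1 v\<close>.\<close>
  from DERIV_divide[OF DERIV_const[of 1] DERIV_cmult[OF this, of "sqrt 2"]]
  have "\<exists>m'. (?m has_real_derivative m') (at v within J)"
    using fw by fastforce
  then obtain m' where m': "(?m has_real_derivative m') (at v within J)" by blast
  have "D_u I ?T u v = (s / sqrt 2 * f2 u) *\<^sub>R L v + (s / sqrt 2 * g2 u) *\<^sub>R xi1"
    by (rule D_u_comb[where a = "\<lambda>u. s / sqrt 2 * f1 u" and b = "\<lambda>u. s / sqrt 2 * g1 u"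
      and C = "?m v *\<^sub>R L1 v"])
      (use u v tangent_field_tangent DERIV_cmult[OF derivs_I(3)[OF u]] DERIV_cmult[OF derivs_I(4)[OF u]] in blast)+
  then have Tu: "D_u I ?T u v = (s / sqrt 2 * \<kappa>m u) *\<^sub>R n2 u v"
    by (simp add: f2_eq g2_eq u n2_def algebra_simps)
  have "((\<lambda>t. (s / sqrt 2 * f1 u) *\<^sub>R L t + (s / sqrt 2 * g1 u) *\<^sub>R xi1 + ?m t *\<^sub>R L1 t)
      has_vector_derivative (s / sqrt 2 * f1 u) *\<^sub>R L1 v + (?m v *\<^sub>R L2 v + m' *\<^sub>R L1 v)) (at v within J)"
    using has_vector_derivative_add[OF has_vector_derivative_add[OF
      has_vector_derivative_scaleR[OF DERIV_const L_has_derivative(1)[OF v]] has_vector_derivative_const]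
      has_vector_derivative_scaleR[OF m' L_has_derivative(2)[OF v]]]
    by simp
  then have Tv: "D_v J ?T u v = (s / sqrt 2 * f1 u) *\<^sub>R L1 v + (?m v *\<^sub>R L2 v + m' *\<^sub>R L1 v)"
    unfolding D_v_def using v intervals u
    by (intro D_eqI_transform[where h = "\<lambda>t. (s / sqrt 2 * f1 u) *\<^sub>R L t + (s / sqrt 2 * g1 u) *\<^sub>R xi1 + ?m t *\<^sub>R L1 t"])
      (simp_all add: tangent_field_tangent)
  have nL1: "mink (L1 v) n = 0" "mink n (L1 v) = 0" and nu: "mink n (D_u I z u v) = 0"
    using n fw unfolding is_normal_at_def z_v[OF v] by (simp_all add: mink_scale_right mink_commute)
  have "mink xi1 n = f1 u * mink n (n2 u v)"
    by (subst xi1_eq[OF u, of v]) (simp add: mink_bilinear nu mink_commute[of _ n])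
  then have "mink (L2 v) n = (speed v)\<^sup>2 * (\<kappa> v * mink n (n1 v) + f1 u * mink n (n2 u v))"
    unfolding L2_eq[OF v] by (simp add: mink_bilinear nL1 mink_commute[of _ n] algebra_simps)
  then have "mink (D_v J ?T u v) n
      = ?m v * ((speed v)\<^sup>2 * (\<kappa> v * mink n (n1 v) + f1 u * mink n (n2 u v)))"
    unfolding Tv by (simp add: mink_bilinear nL1)
  moreover have "mink (D_u I ?T u v) n = s / sqrt 2 * \<kappa>m u * mink n (n2 u v)"
    unfolding Tu by (simp add: mink_bilinear mink_commute)
  ultimately have "mink (nabla I J (tangent r) ?T u v) n
      = r / sqrt 2 * (s / sqrt 2 * \<kappa>m u * mink n (n2 u v))
        + 1 / (sqrt 2 * f u * speed v)
          * (?m v * ((speed v)\<^sup>2 * (\<kappa> v * mink n (n1 v) + f1 u * mink n (n2 u v))))"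
    unfolding nabla_def tangent_def fst_conv snd_conv mink_add_left mink_scale_left by simp
  also have "\<dots> = r * s * \<kappa>m u * mink n (n2 u v) / (sqrt 2 * sqrt 2)
      + (\<kappa> v * mink n (n1 v) + f1 u * mink n (n2 u v)) / f u / (sqrt 2 * sqrt 2)"
    using fw by (simp del: real_sqrt_mult_self add: power2_eq_square mult_ac)
  finally show ?thesis
    by (simp add: add_divide_distrib)
qed

text \<open>A normal vector is determined by its components along \<open>n1\<close> and
  \<open>n2\<close>, because the remainder \<open>r\<close> is orthogonal to a basis of the whole
  space. The minus sign reflects that \<open>n2\<close> is timelike.\<close>

lemma mink_normal:
  assumes u: "u \<in> I" and v: "v \<in> J" and n: "is_normal_at I J z u v n"
  shows "mink n n = (mink n (n1 v))\<^sup>2 - (mink n (n2 u v))\<^sup>2"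
proof -
  define r where "r = n - (mink n (n1 v) *\<^sub>R n1 v - mink n (n2 u v) *\<^sub>R n2 u v)"
  have "is_normal_at I J z u v r"
    using n is_normal_n[OF u v, of "mink n (n1 v)" "- mink n (n2 u v)"]
    by (simp add: r_def is_normal_at_def mink_bilinear)
  then have rz: "mink r (D_u I z u v) = 0" "mink r (L1 v) = 0"
    using f_pos[OF u] by (simp_all add: is_normal_at_def z_v v mink_bilinear)
  have rn: "mink r (n1 v) = 0" "mink r (n2 u v) = 0"
    by (simp_all add: r_def mink_bilinear mink_n1 mink_n2 u v)
  have rxi: "mink r xi1 = 0"
    by (subst xi1_eq[OF u, of v]) (simp add: mink_bilinear rz rn)
  then have rL: "mink r (L v) = 0"
    using rn(2) f1_nonzero[OF u] by (simp add: n2_def mink_bilinear)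
  obtain a b c d where abcd: "r = frame_vec v a b c d"
    using frame_vec_surj by blast
  have d: "d = 0"
    using rxi unfolding abcd xi1_frame_vec[of v] mink_frame_vec by simp
  have ab: "a * \<phi>1 v + b * \<phi> v = 0" "a * \<phi> v - b * \<phi>1 v = 0"
    using rz(2) rn(1) speed_pos[OF v]
    unfolding abcd d L1_def n1_def mink_scale_right mink_frame_vec by auto
  \<comment> \<open>The vector (a, b) is orthogonal to two perpendicular plane vectors, both of
    length \<open>speed v\<close>.\<close>
  have "(a\<^sup>2 + b\<^sup>2) * (speed v)\<^sup>2 = (a * \<phi>1 v + b * \<phi> v)\<^sup>2 + (a * \<phi> v - b * \<phi>1 v)\<^sup>2"
    unfolding speed_sq by (simp add: algebra_simps power2_eq_square)
  then have "a = 0" "b = 0"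
    unfolding ab using speed_pos[OF v] by (simp_all add: sum_power2_eq_zero_iff)
  moreover from this have "c = 0"
    using rL unfolding abcd d L_def mink_frame_vec by simp
  ultimately have "r = 0"
    unfolding abcd d by (simp add: frame_vec_def)
  then have "n = mink n (n1 v) *\<^sub>R n1 v - mink n (n2 u v) *\<^sub>R n2 u v"
    by (simp add: r_def)
  then have "mink n n = mink n (mink n (n1 v) *\<^sub>R n1 v - mink n (n2 u v) *\<^sub>R n2 u v)"
    by simp
  then show ?thesis
    by (simp add: mink_bilinear power2_eq_square)
qed

text \<open>The normal frame enters k only through \<rho>^2 h = sgn h and 4 h \<beta>^2 = (sgn h)
  p^2, where h is the square of H; the sign choices for b and l square away.\<close>

lemma invariant_k_eq:
  assumes u: "u \<in> I" and v: "v \<in> J"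
    and H: "mink (mean_curv I J f g \<phi> u v) (mean_curv I J f g \<phi> u v) \<noteq> 0"
    and frame: "geometric_normal_frame I J f g \<phi> nb nl"
  shows "invariant_k I J f g \<phi> nb nl u v = - (\<kappa>m u * \<kappa> v / f u)\<^sup>2"
proof -
  let ?H = "mean_curv I J f g \<phi> u v"
  define h where "h = mink ?H ?H"
  define p q where "p = \<kappa> v / f u" and "q = \<kappa>m u + f1 u / f u"
  define \<alpha> \<beta> where "\<alpha> = mink (nl u v) (n1 v)" and "\<beta> = mink (nl u v) (n2 u v)"
  have H_eq: "?H = (p / 2) *\<^sub>R n1 v + (q / 2) *\<^sub>R n2 u v"
    unfolding mean_curv_eq[OF u v] p_def q_def by simp
  have H_n: "mink ?H (n1 v) = p / 2" "mink ?H (n2 u v) = - q / 2"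
    unfolding H_eq by (simp_all add: mink_bilinear mink_n1 mink_n2 u v)
  have h_eq: "4 * h = p\<^sup>2 - q\<^sup>2"
    unfolding h_def by (subst (2) H_eq) (simp add: mink_bilinear H_n power2_eq_square field_simps)
  obtain \<rho> where nb: "nb u v = \<rho> *\<^sub>R ?H" "is_normal_at I J z u v (nb u v)" "\<rho>\<^sup>2 * h = sgn h"
    and nl: "is_normal_at I J z u v (nl u v)" "mink (nb u v) (nl u v) = 0"
      "mink (nl u v) (nl u v) = - sgn h"
    using frame u v unfolding geometric_normal_frame_def Let_def h_def
    by (fastforce simp: mink_bilinear power2_eq_square)
  have h0: "h \<noteq> 0" using H by (simp add: h_def)
  have \<rho>: "\<rho> \<noteq> 0" using nb(3) h0 by (auto simp: sgn_if split: if_splits)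
  have orth: "p * \<alpha> + q * \<beta> = 0"
    using nl(2) \<rho> unfolding nb(1) H_eq \<alpha>_def \<beta>_def mink_commute[of "nl u v"]
    by (simp add: mink_bilinear)
  have norm: "\<alpha>\<^sup>2 - \<beta>\<^sup>2 = - sgn h"
    using mink_normal[OF u v nl(1)] nl(3) by (simp add: \<alpha>_def \<beta>_def)
  \<comment> \<open>For both principal tangents \<open>s * s = 1\<close>, and the pairing with
    \<open>nb\<close> becomes the product of H and \<open>nb\<close>. Hence the two numbers \<nu>_1
    and \<nu>_2 coincide.\<close>
  have "mink (nabla I J (tangent s) (tangent_field I J z (tangent s)) u v) (nb u v) = \<rho> * h"
    if "s * s = 1" for s
  proof -
    have "mink (nabla I J (tangent s) (tangent_field I J z (tangent s)) u v) (nb u v)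
        = (p * mink (nb u v) (n1 v) + q * mink (nb u v) (n2 u v)) / 2"
      unfolding mink_nabla_tangent[OF u v nb(2)] that p_def q_def
      by (simp add: algebra_simps add_divide_distrib)
    also have "\<dots> = \<rho> * (4 * h) / 4"
      unfolding nb(1) mink_scale_left H_n h_eq by (simp add: power2_eq_square field_simps)
    finally show ?thesis by simp
  qed
  note \<nu> = this[of 1, simplified] this[of "- 1", simplified]
  \<comment> \<open>Here the product of the two parameters is -1, which reverses the \<kappa>_m
    term; orthogonality of \<open>nl\<close> to H removes the rest.\<close>
  have \<mu>: "mink (nabla I J (tangent 1) (tangent_field I J z (tangent (- 1))) u v) (nl u v) = - \<kappa>m u * \<beta>"
  proof -
    have "mink (nabla I J (tangent 1) (tangent_field I J z (tangent (- 1))) u v) (nl u v)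
        = ((p * \<alpha> + q * \<beta>) - 2 * \<kappa>m u * \<beta>) / 2"
      unfolding mink_nabla_tangent[OF u v nl(1)] p_def q_def \<alpha>_def[symmetric] \<beta>_def[symmetric]
      by (simp add: algebra_simps add_divide_distrib)
    then show ?thesis unfolding orth by simp
  qed
  \<comment> \<open>\<alpha> is eliminated between \<open>orth\<close> and \<open>norm\<close>,
    using p^2 - q^2 = 4 h.\<close>
  have "p\<^sup>2 * \<alpha>\<^sup>2 = q\<^sup>2 * \<beta>\<^sup>2"
    using orth unfolding power_mult_distrib[symmetric] by (simp add: power2_eq_iff eq_neg_iff_add_eq_0)
  then have "p\<^sup>2 * (\<alpha>\<^sup>2 - \<beta>\<^sup>2) = - (4 * h * \<beta>\<^sup>2)"
    unfolding h_eq by (simp add: algebra_simps)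
  then have hb: "4 * h * \<beta>\<^sup>2 = sgn h * p\<^sup>2"
    unfolding norm by (simp add: mult.commute)
  have "invariant_k I J f g \<phi> nb nl u v = - 4 * (\<rho> * h) * (\<rho> * h) * (- \<kappa>m u * \<beta>)\<^sup>2"
    unfolding invariant_k_def Let_def principal_tangents \<nu> \<mu> ..
  also have "\<dots> = - (\<rho>\<^sup>2 * h) * (4 * h * \<beta>\<^sup>2) * (\<kappa>m u)\<^sup>2"
    by (simp add: power2_eq_square)
  also have "\<dots> = - (sgn h * sgn h) * p\<^sup>2 * (\<kappa>m u)\<^sup>2"
    unfolding nb(3) hb by simp
  also have "sgn h * sgn h = 1"
    using h0 by (auto simp: sgn_if)
  finally show ?thesis by (simp add: p_def power_mult_distrib power_divide mult.commute)
qed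

section \<open>Continuity of the curvatures and the equation of the meridian\<close>

lemma continuous_kappa_m: "continuous_on I \<kappa>m"
  unfolding kappa_m_def[abs_def]
  by (intro continuous_on_divide smooth_on_interval_continuous smooth_on_interval_D intervals smooth)
    (use f1_nonzero in blast)

lemma continuous_kappa: "continuous_on J \<kappa>"
proof -
  have pos: "(\<phi>1 v)\<^sup>2 + (\<phi> v)\<^sup>2 > 0" if "v \<in> J" for v
    using surface that by (simp add: meridian_surface_def)
  have "continuous_on J \<phi>" "continuous_on J \<phi>1" "continuous_on J \<phi>2"
    by (intro smooth_on_interval_continuous smooth_on_interval_D intervals smooth)+
  then show ?thesis
    unfolding kappa_def[abs_def] using pos by (intro continuous_intros) force+
qed

text \<open>Both sides say that \<open>f'' = s f f'\<close>.\<close>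

lemma kappa_m_proportional_iff:
  "(\<forall>u\<in>I. \<kappa>m u / f u = s) \<longleftrightarrow> (\<exists>c. \<forall>u\<in>I. f1 u = c + s * (f u)\<^sup>2 / 2)"
proof -
  \<comment> \<open>f' - s f^2 / 2 is a first integral of f'' = s f f'; its constant value is
    \<open>c\<close>.\<close>
  have deriv: "((\<lambda>u. f1 u - s * (f u)\<^sup>2 / 2) has_real_derivative f2 u - s * f u * f1 u) (at u within I)"
    if "u \<in> I" for u
    by (auto intro!: derivative_eq_intros derivs_I that)
  have ode: "\<kappa>m u / f u = s \<longleftrightarrow> f2 u - s * f u * f1 u = 0" if "u \<in> I" for u
    using f_pos[OF that] f1_nonzero[OF that] by (simp add: kappa_m_def divide_eq_eq mult_ac)
  have "convex I"
    using intervals by (simp add: nondegenerate_interval_def is_interval_convex)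
  show ?thesis
  proof
    assume "\<forall>u\<in>I. \<kappa>m u / f u = s"
    then have "((\<lambda>u. f1 u - s * (f u)\<^sup>2 / 2) has_real_derivative 0) (at u within I)" if "u \<in> I" for u
      using deriv[OF that] ode[OF that] that by simp
    from has_field_derivative_zero_constant[OF \<open>convex I\<close> this]
    obtain c where "\<And>u. u \<in> I \<Longrightarrow> f1 u - s * (f u)\<^sup>2 / 2 = c"
      by blast
    then show "\<exists>c. \<forall>u\<in>I. f1 u = c + s * (f u)\<^sup>2 / 2"
      by (auto simp: diff_eq_eq)
  next
    assume "\<exists>c. \<forall>u\<in>I. f1 u = c + s * (f u)\<^sup>2 / 2"
    then obtain c where c: "\<And>u. u \<in> I \<Longrightarrow> f1 u - s * (f u)\<^sup>2 / 2 = c" by force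
    have "f2 u - s * f u * f1 u = 0" if u: "u \<in> I" for u
    proof -
      have "D I (\<lambda>u. f1 u - s * (f u)\<^sup>2 / 2) u = f2 u - s * f u * f1 u"
        using deriv[OF u] intervals u
        by (intro D_eqI) (simp_all add: has_real_derivative_iff_has_vector_derivative)
      moreover have "D I (\<lambda>u. f1 u - s * (f u)\<^sup>2 / 2) u = 0"
        using intervals u c by (intro D_eqI_transform[where h = "\<lambda>_. c"]) simp_all
      ultimately show ?thesis by simp
    qed
    then show "\<forall>u\<in>I. \<kappa>m u / f u = s" using ode by blast
  qed
qed

end

section \<open>Surfaces with constant invariant k\<close>

theorem theorem5p1:
  fixes I J :: "real set"
    and f g \<phi> :: "real \<Rightarrow> real"
    and nb nl :: "real \<Rightarrow> real \<Rightarrow> real ^ 4"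
    and a :: real
  assumes "meridian_surface I J f g \<phi>"
    and "arc_length_meridian I f g"
    and "general_class I J f \<phi>"
    and "\<forall>u\<in>I. \<forall>v\<in>J. mink (mean_curv I J f g \<phi> u v) (mean_curv I J f g \<phi> u v) \<noteq> 0"
    and "geometric_normal_frame I J f g \<phi> nb nl"
    and "a \<noteq> 0"
  shows "(\<forall>u\<in>I. \<forall>v\<in>J. invariant_k I J f g \<phi> nb nl u v = - (a\<^sup>2)) \<longleftrightarrow>
    (\<exists>b. b \<noteq> 0 \<and> (\<forall>v\<in>J. kappa J \<phi> v = b) \<and>
       (\<exists>(y :: real \<Rightarrow> real) c.
          (y = (\<lambda>t. c + a * t\<^sup>2 / (2 * b)) \<or> y = (\<lambda>t. c - a * t\<^sup>2 / (2 * b))) \<and>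
          (\<forall>u\<in>I. D I f u = y (f u))) \<and>
       (\<forall>u\<in>I. D I g u = - 1 / (2 * D I f u)))"
proof -
  interpret arc_length_meridian_surface I J f g \<phi>
    using assms(1,2) by unfold_locales
  have inv: "invariant_k I J f g \<phi> nb nl u v = - (a\<^sup>2) \<longleftrightarrow> (\<kappa>m u / f u * \<kappa> v)\<^sup>2 = a\<^sup>2"
    if "u \<in> I" "v \<in> J" for u v
    using invariant_k_eq[OF that _ assms(5)] assms(4) that by simp
  \<comment> \<open>The two signs in y are the cases s = a/b and s = -a/b of
    \<open>kappa_m_proportional_iff\<close>.\<close>
  have meridian: "(\<exists>(y :: real \<Rightarrow> real) c.
      (y = (\<lambda>t. c + a * t\<^sup>2 / (2 * b)) \<or> y = (\<lambda>t. c - a * t\<^sup>2 / (2 * b))) \<and> (\<forall>u\<in>I. f1 u = y (f u)))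
    \<longleftrightarrow> (\<forall>u\<in>I. \<kappa>m u / f u = a / b) \<or> (\<forall>u\<in>I. \<kappa>m u / f u = - (a / b))" for b
  proof -
    have eqs: "a / b * x / 2 = a * x / (2 * b)" "c + - (a / b) * x / 2 = c - a * x / (2 * b)" for c x
      by simp_all
    show ?thesis
      unfolding kappa_m_proportional_iff eqs by auto
  qed
  have conn: "connected I" "connected J"
    using intervals by (simp_all add: nondegenerate_interval_def is_interval_connected)
  obtain u0 v0 where uv0: "u0 \<in> I" "v0 \<in> J"
    using intervals interior_subset unfolding nondegenerate_interval_def by blast
  show ?thesis
  proof
    assume inv_const: "\<forall>u\<in>I. \<forall>v\<in>J. invariant_k I J f g \<phi> nb nl u v = - (a\<^sup>2)"
    have k: "(\<kappa>m u / f u)\<^sup>2 * (\<kappa> v)\<^sup>2 = a\<^sup>2" if "u \<in> I" "v \<in> J" for u v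
    proof -
      have "(\<kappa>m u / f u * \<kappa> v)\<^sup>2 = a\<^sup>2"
        using inv[OF that] inv_const that by blast
      then show ?thesis unfolding power_mult_distrib .
    qed
    \<comment> \<open>Separation of variables: with u fixed at \<open>u0\<close>, the square of
      \<open>\<kappa>\<close> is constant in v, and continuity on the connected \<open>J\<close>
      makes \<open>\<kappa>\<close> constant.\<close>
    have "\<kappa>m u0 / f u0 \<noteq> 0"
      using k[OF uv0] assms(6) by auto
    then have "(\<kappa> v)\<^sup>2 = (a / (\<kappa>m u0 / f u0))\<^sup>2" if "v \<in> J" for v
      using k[OF uv0(1) that] by (simp add: power_divide field_simps)
    from continuous_on_constant_sq[OF conn(2) continuous_kappa this]
    obtain b where b: "\<forall>v\<in>J. \<kappa> v = b"
      by blast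
    have "b \<noteq> 0"
      using k[OF uv0] b uv0 assms(6) by auto
    then have sq: "(\<kappa>m u / f u)\<^sup>2 = (a / b)\<^sup>2" if "u \<in> I" for u
      using k[OF that uv0(2)] b uv0(2) by (simp add: power_divide field_simps)
    \<comment> \<open>Continuity on the connected \<open>I\<close> selects one sign for all u, so a
      single y serves the whole meridian.\<close>
    have "continuous_on I (\<lambda>u. \<kappa>m u / f u)"
      using f_pos by (intro continuous_on_divide continuous_kappa_m smooth_on_interval_continuous intervals smooth) force
    from continuous_on_constant_sq[OF conn(1) this sq]
    have "(\<forall>u\<in>I. \<kappa>m u / f u = a / b) \<or> (\<forall>u\<in>I. \<kappa>m u / f u = - (a / b))" .
    then show "\<exists>b. b \<noteq> 0 \<and> (\<forall>v\<in>J. \<kappa> v = b) \<and>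
       (\<exists>(y :: real \<Rightarrow> real) c.
          (y = (\<lambda>t. c + a * t\<^sup>2 / (2 * b)) \<or> y = (\<lambda>t. c - a * t\<^sup>2 / (2 * b))) \<and>
          (\<forall>u\<in>I. f1 u = y (f u))) \<and>
       (\<forall>u\<in>I. g1 u = - 1 / (2 * f1 u))"
      unfolding meridian using \<open>b \<noteq> 0\<close> b g1_eq by blast
  next
    assume "\<exists>b. b \<noteq> 0 \<and> (\<forall>v\<in>J. \<kappa> v = b) \<and>
       (\<exists>(y :: real \<Rightarrow> real) c.
          (y = (\<lambda>t. c + a * t\<^sup>2 / (2 * b)) \<or> y = (\<lambda>t. c - a * t\<^sup>2 / (2 * b))) \<and>
          (\<forall>u\<in>I. f1 u = y (f u))) \<and>
       (\<forall>u\<in>I. g1 u = - 1 / (2 * f1 u))"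
    then obtain b where b: "b \<noteq> 0" "\<forall>v\<in>J. \<kappa> v = b"
      "(\<forall>u\<in>I. \<kappa>m u / f u = a / b) \<or> (\<forall>u\<in>I. \<kappa>m u / f u = - (a / b))"
      unfolding meridian by blast
    have "(\<kappa>m u / f u * \<kappa> v)\<^sup>2 = a\<^sup>2" if "u \<in> I" "v \<in> J" for u v
    proof -
      have "(\<kappa>m u / f u)\<^sup>2 = (a / b)\<^sup>2"
        using b(3) that unfolding power2_eq_iff by blast
      then show ?thesis
        using b(1,2) that unfolding power_mult_distrib by (simp add: power_divide)
    qed
    then show "\<forall>u\<in>I. \<forall>v\<in>J. invariant_k I J f g \<phi> nb nl u v = - (a\<^sup>2)"
      using inv by blast
  qed
qed

end
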